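(* Let $E$ be a finite set with $n+1$ points, $\mu$ a probability measure on $E$ with $\mu(x)>0$ for all $x\in E$, and $\mathcal{F}=(f_0,\dots,f_n)$ a real unitary orthonormal basis (UOB) of $L^2(\mu)$ having the hypergroup property at a point $x_0\in E$. Then the sequences $$\left(\lambda_i(x)=\frac{f_i(x)}{f_i(x_0)}\right)_{i=0,\dots,n},\qquad x\in E,$$ are the extremal points of the convex set of all Markov sequences. More precisely, every Markov sequence $(\lambda_i)_i$ can be written uniquely as $$\lambda_i=\int_E\frac{f_i(x)}{f_i(x_0)}\,d\nu(x),\qquad i=0,\dots,n,$$ for some probability measure $\nu$ on $E$; conversely, for every probability measure $\nu$ on $E$ the sequence defined by this formula is a Markov sequence.
   Context: A real UOB of $L^2(\mu)$ is an orthonormal basis $(f_0,\dots,f_n)$ of the real Hilbert space $L^2(\mu)$ with $f_0=1$. It has the hypergroup property (HGP) at $x_0\in E$ if $f_i(x_0)\ne 0$ for all $i$ and, for all $(x,y,z)\in E^3$, $\sum_{i=0}^n \frac{f_i(x)f_i(y)f_i(z)}{f_i(x_0)}\ge 0$. A Markov operator is a linear operator $K$ on functions on $E$ such that $K(1)=1$ and $K$ maps non-negative functions to non-negative functions. A real sequence $\lambda=(\lambda_i)_{i=0,\dots,n}$ is a Markov sequence (associated with $\mathcal{F}$) if the linear operator $K_\lambda$ defined by $K_\lambda(f_i)=\lambda_if_i$ for all $i$ is a Markov operator. *)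

theory Defs
  imports "HOL-Analysis.Analysis" "HOL-Probability.Probability"
begin

text \<open>
  The finite set \<open>E\<close> is the finite type \<open>'a\<close>, and a real function on \<open>E\<close> is an element of
  \<open>real ^ 'a\<close>, where \<open>1\<close> is the constant function and \<open>\<le>\<close> is the pointwise order.
  The indices \<open>0, \<dots>, n\<close> are the elements of a finite type \<open>'i\<close>. Its class \<open>zero\<close> is purely
  syntactic (it has no axioms) and only singles out the index \<open>0\<close>.
  Probability measures on \<open>E\<close> are elements of \<open>'a pmf\<close>.
\<close>

definition L2_inner :: "'a::finite pmf \<Rightarrow> real ^ 'a \<Rightarrow> real ^ 'a \<Rightarrow> real" where
  "L2_inner \<mu> g h = (\<integral>x. g $ x * h $ x \<partial>measure_pmf \<mu>)"

text \<open>
  When \<open>\<mu>\<close> charges every point, no two functions are identified in \<open>L\<^sup>2(\<mu>)\<close>, so \<open>L\<^sup>2(\<mu>)\<close> is all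
  of \<open>real ^ 'a\<close>; being finite-dimensional, it needs no closure of the span.
\<close>

definition real_UOB :: "'a::finite pmf \<Rightarrow> ('i::{finite,zero} \<Rightarrow> real ^ 'a) \<Rightarrow> bool" where
  "real_UOB \<mu> f \<longleftrightarrow>
     (\<forall>i j. L2_inner \<mu> (f i) (f j) = (if i = j then 1 else 0)) \<and>
     span (range f) = UNIV \<and>
     f 0 = 1"

definition hypergroup_property :: "('i::finite \<Rightarrow> real ^ 'a::finite) \<Rightarrow> 'a \<Rightarrow> bool" where
  "hypergroup_property f x0 \<longleftrightarrow>
     (\<forall>i. f i $ x0 \<noteq> 0) \<and>
     (\<forall>x y z. 0 \<le> (\<Sum>i\<in>UNIV. f i $ x * f i $ y * f i $ z / f i $ x0))"

definition markov_operator :: "(real ^ 'a::finite \<Rightarrow> real ^ 'a) \<Rightarrow> bool" where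
  "markov_operator K \<longleftrightarrow> linear K \<and> K 1 = 1 \<and> (\<forall>g. 0 \<le> g \<longrightarrow> 0 \<le> K g)"

text \<open>
  If \<open>f\<close> is a basis, there is exactly one linear \<open>K\<close> with \<open>K (f i) = l $ i *\<^sub>R f i\<close> for all \<open>i\<close>,
  so the existential quantifier below ranges over the single operator \<open>K\<^sub>l\<close>.
\<close>

definition markov_sequences :: "('i::finite \<Rightarrow> real ^ 'a::finite) \<Rightarrow> (real ^ 'i) set" where
  "markov_sequences f =
     {l. \<exists>K. markov_operator K \<and> (\<forall>i. K (f i) = l $ i *\<^sub>R f i)}"

end

theory Submission
  imports Defs
begin

text \<open>
  Write \<open>c x = (f i x / f i x0)\<^sub>i\<close> for the candidate extreme points.
  Each \<open>c x\<close> is a Markov sequence because its operator has the kernel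
  \<open>\<Sum>i. f i x * f i y * f i z / f i x0\<close> with respect to \<open>\<mu>\<close>, which is non-negative by the
  hypergroup property and has the right eigenvalues by orthonormality (the lemma
  \<open>hypergroup_character_in_markov_sequences\<close>).

  Conversely, if \<open>K\<close> is a Markov operator with eigenvalues \<open>l i\<close>, then \<open>g \<mapsto> K g x0\<close> is a
  positive functional sending \<open>1\<close> to \<open>1\<close>, hence integration against a probability \<open>\<nu>\<close>. Applied
  to \<open>f i\<close> it gives \<open>l i * f i x0 = \<integral> f i d\<nu>\<close>, that is, \<open>l = \<integral> c x d\<nu>(x)\<close> (the lemma
  \<open>markov_sequence_eq_barycentre\<close>). So the Markov sequences form the convex hull of the \<open>c x\<close>.

  Uniqueness of \<open>\<nu>\<close> and extremality of every \<open>c x\<close> both come from injectivity of the linear map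
  taking weights \<open>v\<close> on \<open>E\<close> to the combination \<open>\<Sum>x. v x * c x\<close> (the lemma
  \<open>inj_barycentre\<close>). A vector \<open>v\<close> in its kernel is orthogonal to every \<open>f i\<close>
  for the unweighted inner product, and the \<open>f i\<close> span. Injectivity makes the points \<open>c x\<close>
  linearly independent, so their convex hull is a simplex, and they are its vertices.
\<close>

section \<open>Probability vectors on a finite set\<close>

lemma expectation_eq_sum_pmf:
  fixes \<nu> :: "'a::finite pmf" and h :: "'a \<Rightarrow> real"
  shows "(\<integral>x. h x \<partial>measure_pmf \<nu>) = (\<Sum>x\<in>UNIV. pmf \<nu> x * h x)"
  by (subst integral_measure_pmf[of UNIV]) auto

lemma pmf_with_weights_exists:
  fixes w :: "'a::finite \<Rightarrow> real"
  assumes nonneg: "\<And>x. 0 \<le> w x" and "(\<Sum>x\<in>UNIV. w x) = 1"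
  shows "\<exists>\<nu>. \<forall>x. pmf \<nu> x = w x"
proof -
  have "(\<integral>\<^sup>+ x. ennreal (w x) \<partial>count_space UNIV) = 1"
    using assms by (simp add: nn_integral_count_space_finite sum_ennreal)
  then have "pmf (embed_pmf w) x = w x" for x
    by (rule pmf_embed_pmf[OF nonneg])
  then show ?thesis by blast
qed

section \<open>Characters and barycentres\<close>

definition character :: "('i::finite \<Rightarrow> real ^ 'a::finite) \<Rightarrow> 'a \<Rightarrow> 'a \<Rightarrow> real ^ 'i" where
  "character f x0 x = (\<chi> i. f i $ x / f i $ x0)"

text \<open>
  The weights range over all of \<open>real ^ 'a\<close>, not just over probability vectors, so that both
  uniqueness of barycentres and independence of the characters become injectivity of a linear map.
\<close>

definition barycentre :: "('i::finite \<Rightarrow> real ^ 'a::finite) \<Rightarrow> 'a \<Rightarrow> real ^ 'a \<Rightarrow> real ^ 'i" where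
  "barycentre f x0 v = (\<Sum>x\<in>UNIV. v $ x *\<^sub>R character f x0 x)"

lemma linear_barycentre: "linear (barycentre f x0)"
  by (rule linearI) (simp_all add: barycentre_def algebra_simps sum.distrib scaleR_sum_right)

lemma barycentre_axis: "barycentre f x0 (axis x 1) = character f x0 x"
proof -
  have "barycentre f x0 (axis x 1) = (\<Sum>y\<in>UNIV. if y = x then character f x0 y else 0)"
    unfolding barycentre_def by (rule sum.cong) (auto simp: axis_def)
  then show ?thesis by simp
qed

lemma barycentre_pmf:
  "barycentre f x0 (\<chi> x. pmf \<nu> x) = (\<chi> i. \<integral>x. f i $ x / f i $ x0 \<partial>measure_pmf \<nu>)"
  by (simp add: vec_eq_iff barycentre_def character_def expectation_eq_sum_pmf
      sum_divide_distrib)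

text \<open>
  The \<open>i\<close>-th coordinate of a barycentre is, up to the non-zero factor \<open>f i x0\<close>, the Euclidean
  inner product of the weights with \<open>f i\<close>; a spanning family separates vectors.
\<close>

lemma inj_barycentre:
  assumes span: "span (range f) = UNIV" and nz: "\<And>i. f i $ x0 \<noteq> 0"
  shows "inj (barycentre f x0)"
  unfolding linear_injective_0[OF linear_barycentre]
proof (intro allI impI)
  fix v assume v: "barycentre f x0 v = 0"
  have "f i \<bullet> v = 0" for i
  proof -
    have "f i \<bullet> v = f i $ x0 * barycentre f x0 v $ i"
      using nz[of i]
      by (simp add: barycentre_def character_def inner_vec_def sum_distrib_left mult.commute)
    then show ?thesis using v by simp
  qed
  moreover have "v \<in> span (range f)" using span by simp
  ultimately have "orthogonal v v"
    by (intro orthogonal_to_span[of v "range f" v]) (auto simp: orthogonal_def inner_commute)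
  then show "v = 0" by (simp add: orthogonal_self)
qed

lemma independent_characters:
  fixes f :: "'i::finite \<Rightarrow> real ^ 'a::finite"
  assumes "span (range f) = UNIV" and "\<And>i. f i $ x0 \<noteq> 0"
  shows "independent (range (character f x0))"
proof -
  have "range (character f x0) = barycentre f x0 ` range (\<lambda>x. axis x 1)"
    by (simp add: image_image barycentre_axis)
  moreover have "independent (range (\<lambda>x::'a. axis x (1::real)))"
    by (rule independent_mono[OF independent_Basis]) (auto simp: Basis_vec_def)
  moreover have "inj_on (barycentre f x0) (span (range (\<lambda>x. axis x 1)))"
    using inj_barycentre[OF assms] by (rule inj_on_subset) simp
  ultimately show ?thesis
    using linear_independent_injective_image[OF linear_barycentre] by simp
qed

section \<open>Markov sequences\<close>

lemma convex_markov_sequences: "convex (markov_sequences f)"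
proof (rule convexI)
  fix k l and u v :: real
  assume k: "k \<in> markov_sequences f" and l: "l \<in> markov_sequences f"
    and uv: "0 \<le> u" "0 \<le> v" "u + v = 1"
  from k obtain K where K: "markov_operator K" "\<And>i. K (f i) = k $ i *\<^sub>R f i"
    by (auto simp: markov_sequences_def)
  from l obtain L where L: "markov_operator L" "\<And>i. L (f i) = l $ i *\<^sub>R f i"
    by (auto simp: markov_sequences_def)
  let ?M = "\<lambda>g. u *\<^sub>R K g + v *\<^sub>R L g"
  have "linear ?M"
    using K(1) L(1) unfolding markov_operator_def
    by (intro linear_compose_add linear_compose_scale_right) auto
  moreover have "?M 1 = 1"
    using K(1) L(1) uv(3) by (simp add: markov_operator_def flip: scaleR_add_left)
  moreover have "0 \<le> ?M g" if "0 \<le> g" for g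
    using that K(1) L(1) uv by (simp add: markov_operator_def less_eq_vec_def)
  ultimately have "markov_operator ?M" by (simp add: markov_operator_def)
  moreover have "?M (f i) = (u *\<^sub>R k + v *\<^sub>R l) $ i *\<^sub>R f i" for i
    by (simp add: K(2) L(2) scaleR_add_left)
  ultimately show "u *\<^sub>R k + v *\<^sub>R l \<in> markov_sequences f"
    unfolding markov_sequences_def by blast
qed

text \<open>
  The operator of the character at \<open>x\<close> is \<open>\<Sum>i. (f i x / f i x0) (f i \<otimes> f i)\<close>, written with
  \<open>L\<^sup>2\<close> inner products so that orthonormality yields the eigenvalues and \<open>f 0 = 1\<close> yields
  \<open>K 1 = 1\<close>; regrouping the same double sum exposes the hypergroup kernel and hence positivity.
\<close>

lemma hypergroup_character_in_markov_sequences: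
  fixes f :: "'i::{finite,zero} \<Rightarrow> real ^ 'a::finite"
  assumes uob: "real_UOB \<mu> f" and hgp: "hypergroup_property f x0"
  shows "character f x0 x \<in> markov_sequences f"
proof -
  define K where "K g = (\<Sum>i\<in>UNIV. (character f x0 x $ i * L2_inner \<mu> g (f i)) *\<^sub>R f i)" for g
  have inner: "L2_inner \<mu> (f i) (f j) = (if i = j then 1 else 0)" for i j
    using uob by (simp add: real_UOB_def)
  have eigen: "K (f j) = character f x0 x $ j *\<^sub>R f j" for j
  proof -
    have "K (f j) = (\<Sum>i\<in>UNIV. if j = i then character f x0 x $ i *\<^sub>R f i else 0)"
      unfolding K_def by (rule sum.cong) (auto simp: inner)
    then show ?thesis by simp
  qed
  have "linear K"
    by (rule linearI)
      (simp_all add: K_def L2_inner_def expectation_eq_sum_pmf algebra_simps sum.distrib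
        scaleR_sum_right sum_distrib_left)
  moreover have "K 1 = 1"
  proof -
    have "f 0 = 1" using uob by (simp add: real_UOB_def)
    then show ?thesis using eigen[of 0] by (simp add: character_def)
  qed
  moreover have "0 \<le> K g" if g: "0 \<le> g" for g
  proof -
    have "0 \<le> K g $ y" for y
    proof -
      have "K g $ y = (\<Sum>i\<in>UNIV. \<Sum>z\<in>UNIV.
          pmf \<mu> z * g $ z * (f i $ x * f i $ y * f i $ z / f i $ x0))"
        by (simp add: K_def character_def L2_inner_def expectation_eq_sum_pmf
            sum_distrib_left sum_distrib_right mult_ac)
      also have "\<dots> = (\<Sum>z\<in>UNIV.
          pmf \<mu> z * g $ z * (\<Sum>i\<in>UNIV. f i $ x * f i $ y * f i $ z / f i $ x0))"
        by (subst sum.swap) (simp add: sum_distrib_left)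
      also have "0 \<le> \<dots>"
        using g hgp
        by (auto simp: less_eq_vec_def hypergroup_property_def
            intro!: sum_nonneg[where A = "UNIV :: 'a set"] mult_nonneg_nonneg)
      finally show ?thesis .
    qed
    then show ?thesis by (simp add: less_eq_vec_def)
  qed
  ultimately have "markov_operator K" by (simp add: markov_operator_def)
  then show ?thesis
    unfolding markov_sequences_def using eigen by blast
qed

text \<open>
  The representing measure is the row of the Markov matrix at \<open>x0\<close>: it gives to \<open>x\<close> the mass
  \<open>K \<one>\<^sub>x (x0)\<close>.
\<close>

lemma markov_sequence_eq_barycentre:
  fixes f :: "'i::finite \<Rightarrow> real ^ 'a::finite"
  assumes l: "l \<in> markov_sequences f" and nz: "\<And>i. f i $ x0 \<noteq> 0"
  obtains \<nu> where "l = barycentre f x0 (\<chi> x. pmf \<nu> x)"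
proof -
  from l obtain K where K: "markov_operator K" "\<And>i. K (f i) = l $ i *\<^sub>R f i"
    by (auto simp: markov_sequences_def)
  then have "linear K" by (simp add: markov_operator_def)
  have row: "K g $ x0 = (\<Sum>x\<in>UNIV. g $ x * K (axis x 1) $ x0)" for g
  proof -
    have "K g = K (\<Sum>x\<in>UNIV. g $ x *\<^sub>R axis x 1)"
      using basis_expansion[of g] by (simp add: scalar_mult_eq_scaleR)
    also have "\<dots> = (\<Sum>x\<in>UNIV. g $ x *\<^sub>R K (axis x 1))"
      by (simp add: linear_sum[OF \<open>linear K\<close>] linear_scale[OF \<open>linear K\<close>])
    finally show ?thesis by simp
  qed
  have "0 \<le> K (axis x 1) $ x0" for x
  proof -
    have "0 \<le> (axis x 1 :: real ^ 'a)" by (simp add: less_eq_vec_def axis_def)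
    then show ?thesis using K(1) by (simp add: markov_operator_def less_eq_vec_def)
  qed
  moreover have "(\<Sum>x\<in>UNIV. K (axis x 1) $ x0) = 1"
    using row[of 1] K(1) by (simp add: markov_operator_def)
  ultimately obtain \<nu> where \<nu>: "\<And>x. pmf \<nu> x = K (axis x 1) $ x0"
    using pmf_with_weights_exists[of "\<lambda>x. K (axis x 1) $ x0"] by blast
  have "l $ i = barycentre f x0 (\<chi> x. pmf \<nu> x) $ i" for i
  proof -
    have "l $ i * f i $ x0 = (\<Sum>x\<in>UNIV. f i $ x * pmf \<nu> x)"
      using row[of "f i"] by (simp add: K(2) \<nu>)
    then show ?thesis
      using nz[of i]
      by (simp add: barycentre_def character_def field_simps flip: sum_divide_distrib)
  qed
  then have "l = barycentre f x0 (\<chi> x. pmf \<nu> x)" unfolding vec_eq_iff by blast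
  then show thesis by (rule that)
qed

lemma barycentre_pmf_in_convex_hull:
  "barycentre f x0 (\<chi> x. pmf \<nu> x) \<in> convex hull range (character f x0)"
  unfolding barycentre_def
  by (rule convex_sum) (auto simp: sum_pmf_eq_1 hull_inc)

lemma markov_sequences_eq_convex_hull:
  assumes "real_UOB \<mu> f" and hgp: "hypergroup_property f x0"
  shows "markov_sequences f = convex hull range (character f x0)"
proof
  show "markov_sequences f \<subseteq> convex hull range (character f x0)"
  proof
    fix l assume l: "l \<in> markov_sequences f"
    have "f i $ x0 \<noteq> 0" for i using hgp by (simp add: hypergroup_property_def)
    then obtain \<nu> where "l = barycentre f x0 (\<chi> x. pmf \<nu> x)"
      using markov_sequence_eq_barycentre[OF l] by blast
    then show "l \<in> convex hull range (character f x0)"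
      by (simp only: barycentre_pmf_in_convex_hull)
  qed
  show "convex hull range (character f x0) \<subseteq> markov_sequences f"
    using hypergroup_character_in_markov_sequences[OF assms] convex_markov_sequences
    by (intro hull_minimal) auto
qed

section \<open>The simplex of Markov sequences\<close>

theorem theorem2p1:
  fixes n :: nat
    and \<mu> :: "'a::finite pmf"
    and f :: "'i::{finite,zero} \<Rightarrow> real ^ 'a"
    and x0 :: 'a
  assumes "CARD('a) = n + 1"
    and "CARD('i) = n + 1"
    and "\<forall>x. pmf \<mu> x > 0"
    and "real_UOB \<mu> f"
    and "hypergroup_property f x0"
  shows "convex (markov_sequences f)
    \<and> {l. l extreme_point_of markov_sequences f} = range (\<lambda>x. \<chi> i. f i $ x / f i $ x0)
    \<and> (\<forall>l\<in>markov_sequences f. \<exists>!\<nu> :: 'a pmf.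
          \<forall>i. l $ i = (\<integral>x. f i $ x / f i $ x0 \<partial>measure_pmf \<nu>))
    \<and> (\<forall>\<nu> :: 'a pmf.
          (\<chi> i. \<integral>x. f i $ x / f i $ x0 \<partial>measure_pmf \<nu>) \<in> markov_sequences f)"
proof -
  have nz: "f i $ x0 \<noteq> 0" for i
    using assms(5) by (simp add: hypergroup_property_def)
  have span: "span (range f) = UNIV"
    using assms(4) by (simp add: real_UOB_def)
  note hull = markov_sequences_eq_convex_hull[OF assms(4,5)]

  have "\<not> affine_dependent (range (character f x0))"
    using independent_characters[OF span nz] affine_dependent_imp_dependent by blast
  then have extreme: "{l. l extreme_point_of markov_sequences f} = range (character f x0)"
    unfolding hull by (simp add: extreme_point_of_convex_hull_affine_independent)

  have represents_iff: "(\<forall>i. l $ i = (\<integral>x. f i $ x / f i $ x0 \<partial>measure_pmf \<nu>))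
      \<longleftrightarrow> l = barycentre f x0 (\<chi> x. pmf \<nu> x)" for l and \<nu> :: "'a pmf"
    by (simp add: barycentre_pmf vec_eq_iff)
  have unique: "\<exists>!\<nu> :: 'a pmf. \<forall>i. l $ i = (\<integral>x. f i $ x / f i $ x0 \<partial>measure_pmf \<nu>)"
    if l: "l \<in> markov_sequences f" for l
    unfolding represents_iff
  proof (rule ex_ex1I)
    show "\<exists>\<nu> :: 'a pmf. l = barycentre f x0 (\<chi> x. pmf \<nu> x)"
      using markov_sequence_eq_barycentre[OF l nz] by blast
  next
    fix \<nu> \<nu>' :: "'a pmf"
    assume "l = barycentre f x0 (\<chi> x. pmf \<nu> x)" "l = barycentre f x0 (\<chi> x. pmf \<nu>' x)"
    then have "(\<chi> x. pmf \<nu> x) = (\<chi> x. pmf \<nu>' x)"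
      using injD[OF inj_barycentre[OF span nz]] by metis
    then show "\<nu> = \<nu>'" by (simp add: vec_eq_iff pmf_eq_iff)
  qed

  have "(\<chi> i. \<integral>x. f i $ x / f i $ x0 \<partial>measure_pmf \<nu>) \<in> markov_sequences f" for \<nu> :: "'a pmf"
    using barycentre_pmf_in_convex_hull[of f x0 \<nu>] by (simp add: hull barycentre_pmf)
  then show ?thesis
    using convex_markov_sequences extreme unique by (auto simp: character_def[abs_def])
qed

end
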